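(* Let $k\ge2$ and $p$ be coprime integers with $p>k^2$. Then the triple $(p,k^{-2},k)$ (where $k^{-2}$ denotes the inverse of $k^2$ in $\mathbb{Z}/p$) is genus-minimizing if and only if the triple $(k^2,p^{-1},k)$ (where $p^{-1}$ denotes the inverse of $p$ in $\mathbb{Z}/k^2$) is genus-minimizing.
   Context: For an integer $P\ge2$, a nonzero $\kappa\in\mathbb{Z}/P$ and a unit $q\in\mathbb{Z}/P$, let $[\kappa]_P$ be the representative of $\kappa$ in $\{0,\dots,P-1\}$, let $Q=\{aq: a\in\{0,\dots,[\kappa]_P-1\}\}\subset\mathbb{Z}/P$, and let $\tilde Q\subset\mathbb{Z}$ be the preimage of $Q$ under $\mathbb{Z}\to\mathbb{Z}/P$. For $x,y\in\mathbb{Z}/P$ put $v_{(P,q,\kappa)}(x,y)=\#(\mathbb{Z}\cap(\tilde x,\tilde y])\,[\kappa]_P-\#(\tilde Q\cap(\tilde x,\tilde y])\,P$, where $\tilde x<\tilde y$ are any integer lifts of $x,y$ (the value does not depend on the lifts). Put $\bar G(P,q,\kappa)=\max_{x,y\in\mathbb{Z}/P}v_{(P,q,\kappa)}(x,y)$. The triple $(P,q,\kappa)$ is genus-minimizing if $\bar G(P,q,\kappa)<2P$. *)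

theory Defs
  imports "HOL-Number_Theory.Number_Theory"
begin

text \<open>
  Elements of \<open>\<int>/P\<close> are given by integers: a point of \<open>\<int>/P\<close> is identified with its representative
  in \<open>{0..<P}\<close>, and the parameters \<open>q\<close> and \<open>\<kappa>\<close> may be any integers representing their classes
  (only \<open>q mod P\<close> and \<open>\<kappa> mod P\<close> matter). Thus \<open>\<kappa> mod P\<close> is the representative \<open>[\<kappa>]\<^sub>P\<close>, and
  \<open>modular_inverse P n\<close> from the library represents the inverse of \<open>n\<close> in \<open>\<int>/P\<close>.
\<close>

definition admissible_triple :: "int \<Rightarrow> int \<Rightarrow> int \<Rightarrow> bool" where
  "admissible_triple P q \<kappa> \<longleftrightarrow> P \<ge> 2 \<and> \<not> P dvd \<kappa> \<and> coprime q P"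

definition Qset :: "int \<Rightarrow> int \<Rightarrow> int \<Rightarrow> int set" where
  "Qset P q \<kappa> = (\<lambda>a. a * q mod P) ` {0..\<kappa> mod P - 1}"

definition Qtilde :: "int \<Rightarrow> int \<Rightarrow> int \<Rightarrow> int set" where
  "Qtilde P q \<kappa> = {m. m mod P \<in> Qset P q \<kappa>}"

text \<open>The value of \<open>v_triple\<close> computed from integer lifts \<open>s < t\<close>.\<close>

definition v_lift :: "int \<Rightarrow> int \<Rightarrow> int \<Rightarrow> int \<Rightarrow> int \<Rightarrow> int" where
  "v_lift P q \<kappa> s t =
     int (card {s<..t}) * (\<kappa> mod P) - int (card (Qtilde P q \<kappa> \<inter> {s<..t})) * P"

text \<open>
  On \<open>\<int>/P\<close> we use the lifts \<open>x\<close> and \<open>y\<close> or \<open>y + P\<close>, whichever is the first to exceed \<open>x\<close>;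
  lemma \<open>v_triple_eq_v_lift\<close> below shows that every choice of lifts gives the same value.
\<close>

definition v_triple :: "int \<Rightarrow> int \<Rightarrow> int \<Rightarrow> int \<Rightarrow> int \<Rightarrow> int" where
  "v_triple P q \<kappa> x y = v_lift P q \<kappa> x (if x < y then y else y + P)"

definition Gbar :: "int \<Rightarrow> int \<Rightarrow> int \<Rightarrow> int" where
  "Gbar P q \<kappa> = Max {v_triple P q \<kappa> x y | x y. x \<in> {0..<P} \<and> y \<in> {0..<P}}"

definition genus_minimizing :: "int \<Rightarrow> int \<Rightarrow> int \<Rightarrow> bool" where
  "genus_minimizing P q \<kappa> \<longleftrightarrow> Gbar P q \<kappa> < 2 * P"

lemma genus_minimizing_mod:
  "genus_minimizing P (q mod P) (\<kappa> mod P) \<longleftrightarrow> genus_minimizing P q \<kappa>"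
  by (simp add: genus_minimizing_def Gbar_def v_triple_def v_lift_def Qtilde_def Qset_def mod_mult_right_eq)

lemma card_Qset:
  assumes "admissible_triple P q \<kappa>"
  shows "int (card (Qset P q \<kappa>)) = \<kappa> mod P"
proof -
  have P: "P > 0" and cop: "coprime q P"
    using assms by (auto simp: admissible_triple_def)
  have "inj_on (\<lambda>a. a * q mod P) {0..\<kappa> mod P - 1}"
  proof (rule inj_onI)
    fix a b assume ab: "a \<in> {0..\<kappa> mod P - 1}" "b \<in> {0..\<kappa> mod P - 1}"
      and eq: "a * q mod P = b * q mod P"
    have "[a = b] (mod P)"
      using eq cop cong_mult_rcancel[of q P a b] by (simp add: cong_def)
    moreover have "\<kappa> mod P < P" using P by simp
    ultimately show "a = b"
      using ab by (auto simp: cong_def)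
  qed
  then show ?thesis
    using P by (simp add: Qset_def card_image)
qed

lemma bij_betw_mod_period:
  fixes P s :: int
  assumes "P > 0"
  shows "bij_betw (\<lambda>m. m mod P) {s<..s + P} {0..<P}"
proof -
  have "inj_on (\<lambda>m. m mod P) {s<..s + P}"
  proof (rule inj_onI)
    fix a b assume ab: "a \<in> {s<..s + P}" "b \<in> {s<..s + P}" and "a mod P = b mod P"
    then have "P dvd a - b" by (simp add: mod_eq_dvd_iff)
    moreover have "\<bar>a - b\<bar> < P" using ab by auto
    ultimately show "a = b"
      using dvd_imp_le_int[of "a - b" P] assms by fastforce
  qed
  moreover have "(\<lambda>m. m mod P) ` {s<..s + P} = {0..<P}"
  proof (rule card_subset_eq)
    show "(\<lambda>m. m mod P) ` {s<..s + P} \<subseteq> {0..<P}" using assms by auto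
    show "card ((\<lambda>m. m mod P) ` {s<..s + P}) = card {0..<P}"
      using card_image[OF calculation] assms by simp
  qed simp
  ultimately show ?thesis by (simp add: bij_betw_def)
qed

lemma card_Qtilde_period:
  assumes "admissible_triple P q \<kappa>"
  shows "int (card (Qtilde P q \<kappa> \<inter> {s<..s + P})) = \<kappa> mod P"
proof -
  have P: "P > 0" using assms by (auto simp: admissible_triple_def)
  have bij: "bij_betw (\<lambda>m. m mod P) {s<..s + P} {0..<P}"
    by (rule bij_betw_mod_period[OF P])
  have sub: "Qset P q \<kappa> \<subseteq> {0..<P}" using P by (auto simp: Qset_def)
  have "(\<lambda>m. m mod P) ` (Qtilde P q \<kappa> \<inter> {s<..s + P}) = Qset P q \<kappa>"
  proof
    show "Qset P q \<kappa> \<subseteq> (\<lambda>m. m mod P) ` (Qtilde P q \<kappa> \<inter> {s<..s + P})"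
    proof
      fix c assume c: "c \<in> Qset P q \<kappa>"
      then have "c \<in> (\<lambda>m. m mod P) ` {s<..s + P}"
        using sub bij by (auto simp: bij_betw_def)
      then show "c \<in> (\<lambda>m. m mod P) ` (Qtilde P q \<kappa> \<inter> {s<..s + P})"
        using c by (auto simp: Qtilde_def)
    qed
  qed (auto simp: Qtilde_def)
  moreover have "inj_on (\<lambda>m. m mod P) (Qtilde P q \<kappa> \<inter> {s<..s + P})"
    using bij unfolding bij_betw_def by (blast intro: inj_on_subset)
  ultimately have "card (Qtilde P q \<kappa> \<inter> {s<..s + P}) = card (Qset P q \<kappa>)"
    by (metis card_image)
  then show ?thesis using card_Qset[OF assms] by simp
qed

lemma v_lift_add:
  assumes "s \<le> t" "t \<le> u"
  shows "v_lift P q \<kappa> s u = v_lift P q \<kappa> s t + v_lift P q \<kappa> t u"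
proof -
  have "Qtilde P q \<kappa> \<inter> {s<..u} = (Qtilde P q \<kappa> \<inter> {s<..t}) \<union> (Qtilde P q \<kappa> \<inter> {t<..u})"
    using assms by auto
  then have "card (Qtilde P q \<kappa> \<inter> {s<..u}) =
      card (Qtilde P q \<kappa> \<inter> {s<..t}) + card (Qtilde P q \<kappa> \<inter> {t<..u})"
    by (simp add: card_Un_disjoint disjoint_iff)
  then show ?thesis
    using assms by (simp add: v_lift_def algebra_simps)
qed

lemma v_lift_period:
  assumes "admissible_triple P q \<kappa>"
  shows "v_lift P q \<kappa> s (s + P) = 0"
  using card_Qtilde_period[OF assms, of s] assms
  by (simp add: v_lift_def admissible_triple_def)

lemma v_lift_right:
  assumes "admissible_triple P q \<kappa>" "s \<le> t"
  shows "v_lift P q \<kappa> s (t + int n * P) = v_lift P q \<kappa> s t"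
proof (induction n)
  case (Suc n)
  have P: "P > 0" using assms by (auto simp: admissible_triple_def)
  have "s \<le> t + int n * P" using assms(2) P by (simp add: add_increasing2)
  then have "v_lift P q \<kappa> s ((t + int n * P) + P) =
      v_lift P q \<kappa> s (t + int n * P) + v_lift P q \<kappa> (t + int n * P) ((t + int n * P) + P)"
    using P by (intro v_lift_add) auto
  then show ?case
    using Suc v_lift_period[OF assms(1), of "t + int n * P"] by (simp add: algebra_simps)
qed simp

lemma v_lift_shift:
  "v_lift P q \<kappa> (s + c * P) (t + c * P) = v_lift P q \<kappa> s t"
proof -
  have "(\<lambda>m. m + c * P) ` (Qtilde P q \<kappa> \<inter> {s<..t}) = Qtilde P q \<kappa> \<inter> {s + c * P<..t + c * P}"
  proof
    show "Qtilde P q \<kappa> \<inter> {s + c * P<..t + c * P} \<subseteq> (\<lambda>m. m + c * P) ` (Qtilde P q \<kappa> \<inter> {s<..t})"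
    proof
      fix m assume m: "m \<in> Qtilde P q \<kappa> \<inter> {s + c * P<..t + c * P}"
      have "(m - c * P) mod P = m mod P" by (simp add: mod_eq_dvd_iff)
      then have "m - c * P \<in> Qtilde P q \<kappa> \<inter> {s<..t}" using m by (auto simp: Qtilde_def)
      then show "m \<in> (\<lambda>m. m + c * P) ` (Qtilde P q \<kappa> \<inter> {s<..t})" by (rule rev_image_eqI) simp
    qed
  qed (auto simp: Qtilde_def)
  moreover have "inj_on (\<lambda>m. m + c * P) (Qtilde P q \<kappa> \<inter> {s<..t})" by (auto intro: inj_onI)
  ultimately have "card (Qtilde P q \<kappa> \<inter> {s + c * P<..t + c * P}) = card (Qtilde P q \<kappa> \<inter> {s<..t})"
    by (metis card_image)
  then show ?thesis by (simp add: v_lift_def)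
qed

lemma v_lift_cong:
  assumes adm: "admissible_triple P q \<kappa>" and "s < t" "s' < t'"
    and s: "[s = s'] (mod P)" and t: "[t = t'] (mod P)"
  shows "v_lift P q \<kappa> s t = v_lift P q \<kappa> s' t'"
proof -
  have P: "P > 0" using adm by (auto simp: admissible_triple_def)
  obtain c where c: "s' = s + c * P" using s by (metis cong_iff_lin mult.commute)
  obtain d where d: "t' = t + d * P" using t by (metis cong_iff_lin mult.commute)
  define e where "e = d - c"
  have t': "t' = (t + e * P) + c * P" by (simp add: d e_def algebra_simps)
  have lt: "s < t + e * P" using \<open>s' < t'\<close> c t' by simp
  have "v_lift P q \<kappa> s (t + e * P) = v_lift P q \<kappa> s t"
  proof (cases "e \<ge> 0")
    case True
    then show ?thesis using v_lift_right[OF adm, of s t "nat e"] \<open>s < t\<close> by simp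
  next
    case False
    then show ?thesis
      using v_lift_right[OF adm, of s "t + e * P" "nat (- e)"] lt by (simp add: algebra_simps)
  qed
  moreover have "v_lift P q \<kappa> s' t' = v_lift P q \<kappa> s (t + e * P)"
    unfolding c t' by (rule v_lift_shift)
  ultimately show ?thesis by simp
qed

lemma v_triple_eq_v_lift:
  assumes "admissible_triple P q \<kappa>" "x \<in> {0..<P}" "y \<in> {0..<P}"
    and "s < t" "[s = x] (mod P)" "[t = y] (mod P)"
  shows "v_triple P q \<kappa> x y = v_lift P q \<kappa> s t"
proof -
  define y' where "y' = (if x < y then y else y + P)"
  have "x < y'" using assms(2,3) by (simp add: y'_def)
  moreover have "[y' = t] (mod P)" using assms(6) by (simp add: y'_def cong_def)
  moreover have "[x = s] (mod P)" using assms(5) by (rule cong_sym)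
  ultimately show ?thesis
    unfolding v_triple_def y'_def[symmetric] using v_lift_cong[OF assms(1)] assms(4) by blast
qed

lemma admissible_triple_1:
  assumes "k \<ge> 2" "coprime k p" "p > k\<^sup>2"
  shows "admissible_triple p (modular_inverse p (k\<^sup>2)) k"
proof -
  have "k * 1 < k * k" using assms(1) by (intro mult_strict_left_mono) auto
  then have "k < p" using assms(3) by (simp add: power2_eq_square)
  then have "\<not> p dvd k" using assms(1) by (intro zdvd_not_zless) auto
  then show ?thesis
    using assms \<open>k < p\<close> by (simp add: admissible_triple_def)
qed

lemma admissible_triple_2:
  assumes "k \<ge> 2" "coprime k p"
  shows "admissible_triple (k\<^sup>2) (modular_inverse (k\<^sup>2) p) k"
proof -
  have "k * 1 < k * k" using assms(1) by (intro mult_strict_left_mono) auto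
  then have lt: "k < k\<^sup>2" by (simp add: power2_eq_square)
  then have "\<not> k\<^sup>2 dvd k" using assms(1) by (intro zdvd_not_zless) auto
  moreover have "coprime (modular_inverse (k\<^sup>2) p) (k\<^sup>2)"
    using assms(2) by (intro coprime_modular_inverse) (simp add: coprime_commute)
  ultimately show ?thesis
    using assms(1) lt unfolding admissible_triple_def by linarith
qed

end

theory Submission
  imports Defs
begin

text \<open>
  The idea is that the two triples see the same lattice points. Since \<open>q\<close> is inverse to \<open>k\<^sup>2\<close>
  modulo \<open>p\<close>, an integer \<open>m\<close> lies in the first set \<open>Qtilde\<close> iff \<open>k\<^sup>2 m = p n + a\<close> for some \<open>n\<close> and
  some \<open>0 \<le> a < k\<close>. The same equation, read modulo \<open>k\<^sup>2\<close> as \<open>p (- n) \<equiv> a\<close>, says that \<open>- n\<close> lies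
  in the second set \<open>Qtilde\<close>. As \<open>a < k\<close> is smaller than both moduli, \<open>m\<close> and \<open>n\<close> determine each
  other, so \<open>m \<mapsto> - n\<close> is an order-reversing bijection between the two sets (lemma
  \<open>bij_betw_dual\<close>).

  On the other hand \<open>v\<close> only decreases at points of \<open>Qtilde\<close>, so it is maximal on an interval that
  starts at a point \<open>m\<close> of \<open>Qtilde\<close> and stops just before another one, \<open>m'\<close>. Being
  genus-minimizing is thus one inequality for each pair \<open>m < m'\<close> in \<open>Qtilde\<close>, which involves \<open>m' - m\<close>
  and the number \<open>N\<close> of points of \<open>Qtilde\<close> in \<open>[m, m']\<close> (lemma \<open>genus_minimizing_iff_gaps\<close>). The
  bijection preserves \<open>N\<close> and changes \<open>m' - m\<close> by the factor \<open>k\<^sup>2 / p\<close>, up to the bounded error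
  \<open>d = a' - a\<close>. With \<open>E = (n' - n) - k N\<close> the two inequalities for corresponding pairs become
  \<open>p E + d < k\<^sup>2\<close> and \<open>E \<le> 0\<close>. These are equivalent because \<open>\<bar>d\<bar> < k\<close> and \<open>p > k\<^sup>2\<close>; only \<open>E = 1\<close>
  needs an argument, and there \<open>p + d\<close> is a multiple of \<open>k\<close> exceeding \<open>k\<^sup>2 - k\<close>
  (lemma \<open>gap_inequality_transfer\<close>).
\<close>

section \<open>Genus-minimization as a condition on gaps\<close>

lemma mem_Qtilde_iff:
  assumes "P > 0" and inv: "[q * r = 1] (mod P)"
  shows "m \<in> Qtilde P q \<kappa> \<longleftrightarrow> m * r mod P < \<kappa> mod P"
proof
  assume "m \<in> Qtilde P q \<kappa>"
  then obtain a where a: "0 \<le> a" "a < \<kappa> mod P" and m: "[m = a * q] (mod P)"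
    by (auto simp: Qtilde_def Qset_def cong_def)
  have "[m * r = a * (q * r)] (mod P)"
    using cong_scalar_right[OF m, of r] by (simp add: mult.assoc)
  also have "[a * (q * r) = a] (mod P)"
    using cong_scalar_left[OF inv, of a] by simp
  finally have "m * r mod P = a mod P" by (simp add: cong_def)
  moreover have "a < P" using a pos_mod_bound[OF \<open>P > 0\<close>, of \<kappa>] by linarith
  ultimately show "m * r mod P < \<kappa> mod P" using a by simp
next
  assume less: "m * r mod P < \<kappa> mod P"
  have "[m * r mod P * q = m * r * q] (mod P)"
    by (intro cong_scalar_right) (simp add: cong_def)
  also have "[m * r * q = m] (mod P)"
    using cong_scalar_left[OF inv, of m] by (simp add: ac_simps)
  finally have "m mod P = (m * r mod P) * q mod P" by (simp add: cong_def)
  then show "m \<in> Qtilde P q \<kappa>"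
    using less \<open>P > 0\<close> by (auto simp: Qtilde_def Qset_def)
qed

lemma genus_minimizing_iff_v_lift:
  assumes adm: "admissible_triple P q \<kappa>"
  shows "genus_minimizing P q \<kappa> \<longleftrightarrow> (\<forall>s t. s < t \<longrightarrow> v_lift P q \<kappa> s t < 2 * P)"
proof -
  have P: "P > 0" using adm by (auto simp: admissible_triple_def)
  let ?V = "{v_triple P q \<kappa> x y | x y. x \<in> {0..<P} \<and> y \<in> {0..<P}}"
  have mem: "v_triple P q \<kappa> x y \<in> ?V" if "x \<in> {0..<P}" "y \<in> {0..<P}" for x y
    using that by blast
  have "finite {x. x \<in> {0..<P}}" by simp
  from finite_image_set2[OF this this] have fin: "finite ?V" .
  have "v_triple P q \<kappa> 0 0 \<in> ?V" using P by (intro mem) simp_all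
  then have "?V \<noteq> {}" by (metis empty_iff)
  then have "genus_minimizing P q \<kappa> \<longleftrightarrow> (\<forall>v\<in>?V. v < 2 * P)"
    unfolding genus_minimizing_def Gbar_def by (rule Max_less_iff[OF fin])
  also have "\<dots> \<longleftrightarrow> (\<forall>s t. s < t \<longrightarrow> v_lift P q \<kappa> s t < 2 * P)"
  proof (intro iffI allI impI)
    fix s t :: int
    assume V: "\<forall>v\<in>?V. v < 2 * P" and "s < t"
    have "v_triple P q \<kappa> (s mod P) (t mod P) = v_lift P q \<kappa> s t"
      using P \<open>s < t\<close> by (intro v_triple_eq_v_lift[OF adm]) (auto simp: cong_def)
    moreover have "v_triple P q \<kappa> (s mod P) (t mod P) < 2 * P"
      using P by (intro bspec[OF V] mem) simp_all
    ultimately show "v_lift P q \<kappa> s t < 2 * P" by simp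
  next
    assume L: "\<forall>s t. s < t \<longrightarrow> v_lift P q \<kappa> s t < 2 * P"
    show "\<forall>v\<in>?V. v < 2 * P"
    proof
      fix v assume "v \<in> ?V"
      then obtain x y where v: "v = v_triple P q \<kappa> x y" and "x \<in> {0..<P} \<and> y \<in> {0..<P}"
        by blast
      then show "v < 2 * P" using L by (simp add: v_triple_def)
    qed
  qed
  finally show ?thesis .
qed

lemma v_lift_before_point:
  assumes "m < m'" "m \<in> Qtilde P q \<kappa>" "m' \<in> Qtilde P q \<kappa>"
  shows "v_lift P q \<kappa> m (m' - 1) =
    (\<kappa> mod P) * (m' - m - 1) + 2 * P - P * int (card (Qtilde P q \<kappa> \<inter> {m..m'}))"
proof -
  have "Qtilde P q \<kappa> \<inter> {m..m'} = insert m (insert m' (Qtilde P q \<kappa> \<inter> {m<..m' - 1}))"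
    using assms by auto
  then have "card (Qtilde P q \<kappa> \<inter> {m..m'}) = card (Qtilde P q \<kappa> \<inter> {m<..m' - 1}) + 2"
    using assms(1) by simp
  then show ?thesis using assms(1) by (simp add: v_lift_def algebra_simps)
qed

text \<open>
  Enlarging an interval without meeting a point of \<open>Qtilde\<close> increases \<open>v\<close>, so every interval may be
  extended to the left until it starts at a point of \<open>Qtilde\<close> and to the right until just before
  the next point.
\<close>

lemma v_lift_le_before_point:
  assumes P: "P > 0" and \<kappa>: "\<kappa> mod P > 0" and "s < t"
  obtains m m' where "m \<in> Qtilde P q \<kappa>" "m' \<in> Qtilde P q \<kappa>" "m < m'"
    "v_lift P q \<kappa> s t \<le> v_lift P q \<kappa> m (m' - 1)"
proof -
  let ?Q = "Qtilde P q \<kappa>"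
  \<comment> \<open>Multiples of \<open>P\<close> belong to \<open>Qtilde\<close> (take \<open>a = 0\<close>), so it has points on both sides.\<close>
  have mult: "c * P \<in> ?Q" for c
    using \<kappa> by (auto simp: Qtilde_def Qset_def intro!: image_eqI[of _ _ 0])
  define l where "l = s div P * P"
  define u where "u = (t div P + 1) * P"
  have "l \<le> s"
    using div_mult_mod_eq[of s P] pos_mod_sign[OF P, of s] unfolding l_def by linarith
  have "t < u"
    using div_mult_mod_eq[of t P] pos_mod_bound[OF P, of t]
    unfolding u_def distrib_right by linarith
  define m where "m = Max (?Q \<inter> {l..s})"
  define m' where "m' = Min (?Q \<inter> {t<..u})"
  have "l \<in> ?Q \<inter> {l..s}" using mult \<open>l \<le> s\<close> by (simp add: l_def)
  then have m: "m \<in> ?Q \<inter> {l..s}" unfolding m_def by (intro Max_in) auto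
  have m_max: "x \<le> m" if "x \<in> ?Q" "x \<le> s" for x
  proof (cases "l \<le> x")
    case True
    then show ?thesis using that by (auto simp: m_def intro: Max_ge)
  qed (use m in auto)
  have "u \<in> ?Q \<inter> {t<..u}" using mult \<open>t < u\<close> by (simp add: u_def)
  then have m': "m' \<in> ?Q \<inter> {t<..u}" unfolding m'_def by (intro Min_in) auto
  have m'_min: "m' \<le> x" if "x \<in> ?Q" "t < x" for x
  proof (cases "x \<le> u")
    case True
    then show ?thesis using that by (auto simp: m'_def intro: Min_le)
  qed (use m' in auto)
  have "?Q \<inter> {m<..m' - 1} = ?Q \<inter> {s<..t}"
    using m_max m'_min m m' by fastforce
  moreover have "int (card {s<..t}) * (\<kappa> mod P) \<le> int (card {m<..m' - 1}) * (\<kappa> mod P)"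
    using m m' \<kappa> \<open>s < t\<close> by (intro mult_right_mono) auto
  ultimately have "v_lift P q \<kappa> s t \<le> v_lift P q \<kappa> m (m' - 1)"
    by (simp add: v_lift_def)
  moreover have "m < m'" using m m' \<open>s < t\<close> by auto
  ultimately show thesis using m m' that by blast
qed

lemma genus_minimizing_iff_gaps:
  assumes adm: "admissible_triple P q \<kappa>"
  shows "genus_minimizing P q \<kappa> \<longleftrightarrow>
    (\<forall>m\<in>Qtilde P q \<kappa>. \<forall>m'\<in>Qtilde P q \<kappa>. m < m' \<longrightarrow>
      (\<kappa> mod P) * (m' - m - 1) < P * int (card (Qtilde P q \<kappa> \<inter> {m..m'})))"
    (is "_ \<longleftrightarrow> ?gaps")
proof -
  have P: "P > 0" using adm by (auto simp: admissible_triple_def)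
  have \<kappa>: "\<kappa> mod P > 0"
    using adm pos_mod_sign[OF P, of \<kappa>] by (auto simp: admissible_triple_def dvd_eq_mod_eq_0 less_le)
  show ?thesis
    unfolding genus_minimizing_iff_v_lift[OF adm]
  proof (intro iffI allI impI ballI)
    fix m m'
    assume L: "\<forall>s t. s < t \<longrightarrow> v_lift P q \<kappa> s t < 2 * P"
      and m: "m \<in> Qtilde P q \<kappa>" "m' \<in> Qtilde P q \<kappa>" "m < m'"
    have "v_lift P q \<kappa> m (m' - 1) < 2 * P"
    proof (cases "m < m' - 1")
      case False
      \<comment> \<open>For adjacent points the interval is empty.\<close>
      then have "{m<..m' - 1} = {}" by auto
      then show ?thesis using P by (simp add: v_lift_def)
    qed (use L in simp)
    then show "(\<kappa> mod P) * (m' - m - 1) < P * int (card (Qtilde P q \<kappa> \<inter> {m..m'}))"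
      using v_lift_before_point[OF m(3,1,2)] by simp
  next
    fix s t :: int
    assume ?gaps and "s < t"
    obtain m m' where m: "m \<in> Qtilde P q \<kappa>" "m' \<in> Qtilde P q \<kappa>" "m < m'"
      and le: "v_lift P q \<kappa> s t \<le> v_lift P q \<kappa> m (m' - 1)"
      using v_lift_le_before_point[OF P \<kappa> \<open>s < t\<close>] by blast
    note le
    also have "v_lift P q \<kappa> m (m' - 1) < 2 * P"
      using v_lift_before_point[OF m(3,1,2)] \<open>?gaps\<close> m by simp
    finally show "v_lift P q \<kappa> s t < 2 * P" .
  qed
qed

section \<open>The duality between the two point sets\<close>

text \<open>
  The common form of the two sets \<open>Qtilde\<close>. For \<open>0 < c \<le> A\<close>, a point of \<open>residue_set A B c\<close> is an
  \<open>m\<close> for which there is a lattice point \<open>(m, n)\<close> with \<open>0 \<le> B m - A n < c\<close>; this \<open>n\<close> is unique, and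
  \<open>dual A B m\<close> is \<open>- n\<close>. The sign makes the situation symmetric under exchanging \<open>A\<close> and \<open>B\<close>, as \<open>B m - A n = A (- n) - B (- m)\<close>.
\<close>

definition residue_set :: "int \<Rightarrow> int \<Rightarrow> int \<Rightarrow> int set" where
  "residue_set A B c = {m. m * B mod A < c}"

definition dual :: "int \<Rightarrow> int \<Rightarrow> int \<Rightarrow> int" where
  "dual A B m = - (m * B div A)"

lemma dual_eq: "m * B + dual A B m * A = m * B mod A"
  by (simp add: dual_def minus_div_mult_eq_mod)

lemma dual_mod:
  assumes "A > 0" "c \<le> B" "m \<in> residue_set A B c"
  shows "dual A B m * A mod B = m * B mod A"
proof -
  have "0 \<le> m * B mod A" "m * B mod A < B"
    using assms by (auto simp: residue_set_def)
  moreover have "dual A B m * A = m * B mod A + (- m) * B"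
    using dual_eq[of m B A] by simp
  ultimately show ?thesis by (simp only: mod_mult_self1 mod_pos_pos_trivial)
qed

lemma dual_in_residue_set:
  assumes "A > 0" "c \<le> B" "m \<in> residue_set A B c"
  shows "dual A B m \<in> residue_set B A c"
  using dual_mod[OF assms] assms(3) by (simp add: residue_set_def)

lemma dual_dual:
  assumes "A > 0" "B > 0" "c \<le> B" "m \<in> residue_set A B c"
  shows "dual B A (dual A B m) = m"
proof -
  have "dual A B m * A + dual B A (dual A B m) * B = m * B + dual A B m * A"
    using dual_eq[of "dual A B m" A B] dual_eq[of m B A] dual_mod[OF assms(1,3,4)] by simp
  then show ?thesis using assms(2) by simp
qed

lemma dual_antimono:
  assumes "A > 0" "B > 0" "m \<le> m'"
  shows "dual A B m' \<le> dual A B m"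
  using assms by (auto simp: dual_def intro!: zdiv_mono1 mult_right_mono)

lemma dual_strict_antimono:
  assumes "A > 0" "B > 0" "c \<le> B"
    and "m \<in> residue_set A B c" "m' \<in> residue_set A B c" "m < m'"
  shows "dual A B m' < dual A B m"
proof -
  have "dual A B m \<noteq> dual A B m'"
    using dual_dual[OF assms(1-3)] assms(4-6) by (metis less_irrefl)
  then show ?thesis using dual_antimono[OF assms(1,2), of m m'] assms(6) by simp
qed

lemma bij_betw_dual:
  assumes "A > 0" "B > 0" "c \<le> A" "c \<le> B"
    and "m \<in> residue_set A B c" "m' \<in> residue_set A B c"
  shows "bij_betw (dual A B) (residue_set A B c \<inter> {m..m'})
    (residue_set B A c \<inter> {dual A B m'..dual A B m})"
proof (rule bij_betw_byWitness[where f' = "dual B A"])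
  show "dual A B ` (residue_set A B c \<inter> {m..m'})
      \<subseteq> residue_set B A c \<inter> {dual A B m'..dual A B m}"
    using assms by (auto intro: dual_in_residue_set dual_antimono)
  have "m \<le> dual B A n \<and> dual B A n \<le> m'" if "dual A B m' \<le> n" "n \<le> dual A B m" for n
    using dual_antimono[OF assms(2,1) that(1)] dual_antimono[OF assms(2,1) that(2)]
      dual_dual[OF assms(1,2,4,5)] dual_dual[OF assms(1,2,4,6)] by simp
  then show "dual B A ` (residue_set B A c \<inter> {dual A B m'..dual A B m})
      \<subseteq> residue_set A B c \<inter> {m..m'}"
    using assms by (auto intro: dual_in_residue_set)
qed (use assms in \<open>auto intro: dual_dual\<close>)

text \<open>
  As \<open>dual A B\<close> and \<open>dual B A\<close> are order-reversing and inverse to each other, every increasing pair on one side is the image of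
  exactly one increasing pair on the other side, with its two points exchanged.
\<close>

lemma all_pairs_dual:
  assumes "A > 0" "B > 0" "c \<le> A" "c \<le> B"
  shows "(\<forall>n\<in>residue_set B A c. \<forall>n'\<in>residue_set B A c. n < n' \<longrightarrow> R n n') \<longleftrightarrow>
    (\<forall>m\<in>residue_set A B c. \<forall>m'\<in>residue_set A B c. m < m' \<longrightarrow> R (dual A B m') (dual A B m))"
    (is "?L \<longleftrightarrow> ?R")
proof (intro iffI ballI impI)
  fix m m' assume ?L and m: "m \<in> residue_set A B c" "m' \<in> residue_set A B c" "m < m'"
  then have "dual A B m' < dual A B m"
    by (intro dual_strict_antimono[OF assms(1,2,4)])
  then show "R (dual A B m') (dual A B m)"
    using \<open>?L\<close> dual_in_residue_set[OF assms(1,4)] m by blast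
next
  fix n n' assume ?R and n: "n \<in> residue_set B A c" "n' \<in> residue_set B A c" "n < n'"
  have nn: "dual A B (dual B A n) = n" "dual A B (dual B A n') = n'"
    using dual_dual[OF assms(2,1,3)] n by auto
  have "dual B A n' < dual B A n"
    using n by (intro dual_strict_antimono[OF assms(2,1,3)])
  then show "R n n'"
    using \<open>?R\<close> dual_in_residue_set[OF assms(2,3)] n nn by metis
qed

section \<open>Comparison of the gap inequalities\<close>

text \<open>
  Here \<open>x\<close> and \<open>y\<close> are the distances in two corresponding pairs of points, \<open>N\<close> is the number of
  points that each pair spans, and \<open>d\<close> is the difference of the residues at its ends.
\<close>

lemma gap_inequality_transfer:
  fixes k p x y d N :: int
  assumes "k \<ge> 2" "p > k\<^sup>2" and d: "\<bar>d\<bar> < k" and eq: "k\<^sup>2 * x = p * y + d"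
  shows "k * (x - 1) < p * N \<longleftrightarrow> k * (y - 1) < k\<^sup>2 * N"
proof -
  define E where "E = y - k * N"
  have "k * k \<ge> 2 * k" using assms(1) by (intro mult_right_mono) auto
  then have k2: "k\<^sup>2 \<ge> 2 * k" by (simp add: power2_eq_square)
  have "k * (x - 1) < p * N \<longleftrightarrow> k * (k * (x - 1)) < k * (p * N)"
    using assms(1) by simp
  also have "\<dots> \<longleftrightarrow> p * E + d < k\<^sup>2"
    using eq by (simp add: E_def power2_eq_square algebra_simps)
  also have "\<dots> \<longleftrightarrow> E \<le> 0"
  proof
    assume "E \<le> 0"
    moreover have "0 \<le> p" using assms(2) k2 assms(1) by linarith
    ultimately have "p * E \<le> 0" by (simp add: mult_nonneg_nonpos)
    then show "p * E + d < k\<^sup>2" using d k2 by linarith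
  next
    assume less: "p * E + d < k\<^sup>2"
    show "E \<le> 0"
    proof (rule ccontr)
      assume "\<not> E \<le> 0"
      then consider "E = 1" | "E \<ge> 2" by linarith
      then show False
      proof cases
        case 1
        \<comment> \<open>Now \<open>y = k N + 1\<close>, so \<open>k\<close> divides \<open>p + d\<close>, which leaves no room between
          \<open>k\<^sup>2 - k\<close> and \<open>k\<^sup>2\<close>.\<close>
        then have "p + d = k * (k * x - p * N)"
          using eq by (simp add: E_def power2_eq_square algebra_simps)
        moreover define z where "z = k * x - p * N"
        ultimately have z: "p + d = k * z" by simp
        have "k * z < k * k" using less 1 z by (simp add: power2_eq_square)
        then have "z \<le> k - 1" using assms(1) by simp
        then have "k * z \<le> k * (k - 1)" using assms(1) by (intro mult_left_mono) auto
        then show False using z d assms(2) by (simp add: power2_eq_square algebra_simps)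
      next
        case 2
        then have "p * 2 \<le> p * E"
          using assms(1,2) k2 by (intro mult_left_mono) auto
        then show False using less d assms(2) k2 by linarith
      qed
    qed
  qed
  also have "\<dots> \<longleftrightarrow> y - 1 < k * N" by (auto simp: E_def)
  also have "\<dots> \<longleftrightarrow> k * (y - 1) < k * (k * N)" using assms(1) by simp
  finally show ?thesis by (simp add: power2_eq_square mult.assoc)
qed

theorem proposition4p1:
  fixes k p :: int
  assumes "k \<ge> 2" and "coprime k p" and "p > k\<^sup>2"
  shows "genus_minimizing p (modular_inverse p (k\<^sup>2)) k \<longleftrightarrow>
         genus_minimizing (k\<^sup>2) (modular_inverse (k\<^sup>2) p) k"
proof -
  define K where "K = k\<^sup>2"
  let ?S = "residue_set p K k" and ?T = "residue_set K p k"
  have "k * 1 < k * k" using assms(1) by (intro mult_strict_left_mono) auto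
  then have kK: "k < K" by (simp add: K_def power2_eq_square)
  have Kp: "K < p" using assms(3) by (simp add: K_def)
  have pos: "p > 0" "K > 0" and le: "k \<le> p" "k \<le> K" and k_mod: "k mod p = k" "k mod K = k"
    using kK Kp assms(1) by auto
  have cop: "coprime K p" using assms(2) by (simp add: K_def)
  have inv: "[modular_inverse p K * K = 1] (mod p)" "[modular_inverse K p * p = 1] (mod K)"
    using cop coprime_commute[of K p] by (blast intro: cong_modular_inverse2)+
  have Q: "Qtilde p (modular_inverse p K) k = ?S" "Qtilde K (modular_inverse K p) k = ?T"
    by (simp_all add: set_eq_iff residue_set_def k_mod
        mem_Qtilde_iff[OF pos(1) inv(1)] mem_Qtilde_iff[OF pos(2) inv(2)])

  have "genus_minimizing p (modular_inverse p K) k \<longleftrightarrow>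
      (\<forall>m\<in>?S. \<forall>m'\<in>?S. m < m' \<longrightarrow> k * (m' - m - 1) < p * int (card (?S \<inter> {m..m'})))"
    using genus_minimizing_iff_gaps[OF admissible_triple_1[OF assms]] Q k_mod
    by (simp add: K_def)
  also have "\<dots> \<longleftrightarrow> (\<forall>m\<in>?S. \<forall>m'\<in>?S. m < m' \<longrightarrow>
      k * (dual p K m - dual p K m' - 1) < K * int (card (?T \<inter> {dual p K m'..dual p K m})))"
  proof (intro ball_cong refl imp_cong)
    fix m m' assume m: "m \<in> ?S" "m' \<in> ?S"
    let ?d = "m' * K mod p - m * K mod p"
    have "0 \<le> m * K mod p" "0 \<le> m' * K mod p" using pos by simp_all
    then have d: "\<bar>?d\<bar> < k"
      using m by (simp add: residue_set_def abs_less_iff)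
    have eq: "k\<^sup>2 * (m' - m) = p * (dual p K m - dual p K m') + ?d"
      using dual_eq[of m K p] dual_eq[of m' K p] by (simp add: K_def algebra_simps)
    have "card (?T \<inter> {dual p K m'..dual p K m}) = card (?S \<inter> {m..m'})"
      using bij_betw_same_card[OF bij_betw_dual[OF pos le m]] by simp
    then show "k * (m' - m - 1) < p * int (card (?S \<inter> {m..m'})) \<longleftrightarrow>
        k * (dual p K m - dual p K m' - 1) < K * int (card (?T \<inter> {dual p K m'..dual p K m}))"
      using gap_inequality_transfer[OF assms(1,3) d eq] by (simp add: K_def)
  qed
  also have "\<dots> \<longleftrightarrow>
      (\<forall>n\<in>?T. \<forall>n'\<in>?T. n < n' \<longrightarrow> k * (n' - n - 1) < K * int (card (?T \<inter> {n..n'})))"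
    by (rule all_pairs_dual[OF pos le, symmetric])
  also have "\<dots> \<longleftrightarrow> genus_minimizing K (modular_inverse K p) k"
    using genus_minimizing_iff_gaps[OF admissible_triple_2[OF assms(1,2)]] Q k_mod
    by (simp add: K_def)
  finally show ?thesis by (simp add: K_def)
qed

end
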